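(* Let $A$ be a compact metric space without isolated points, $f:A\to A$ a continuous map, and $\mu$ a Borel probability measure on $A$ with full support such that the measure-preserving system $(A,\mu,f)$ is weakly mixing. Let $h:A\to\mathbb{C}$ be a continuous function with $\gamma=\int_A\log|h|\,d\mu$ finite. Let $X$ be an infinite dimensional separable complex Banach space, $T$ a bounded linear operator on $X$, and let $P:A\times X\to A\times X$ be the skew product $P(a,x)=(f(a),h(a)Tx)$. Suppose there exist two dense subsets $D_1,D_2$ of $X$, a syndetic (increasing) sequence $(n_k)$ of positive integers and a sequence of mappings $S_{n_k}:D_2\to X$ such that (i) $\limsup_k\|T^{n_k}x\|^{1/n_k}<e^{-\gamma}$ for every $x\in D_1$; (ii) $\limsup_k\|S_{n_k}y\|^{1/n_k}<e^{\gamma}$ for every $y\in D_2$; (iii) $\|T^{n_k}S_{n_k}y-y\|\to0$ as $k\to\infty$ for every $y\in D_2$. Then $(A\times X,P)$ is (topologically) weakly mixing. Moreover, the set $\{(a,b)\in A\times A: (a,x,b,y)\in \mathrm{Trans}_{P\times P}\text{ for some }x,y\in X\}$ has measure $1$ with respect to the product measure $\mu\times\mu$.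
   Context: A continuous self-map $S$ of a space $Y$ is topologically transitive if for all nonempty open $U,V\subset Y$ there is an integer $n\ge1$ with $S^n(U)\cap V\ne\emptyset$; $(Y,S)$ is topologically weakly mixing if $S\times S$ on $Y\times Y$ is topologically transitive. $\mathrm{Trans}_S$ is the set of transitive points, i.e. points $y$ with $\{S^ny:n\ge0\}$ dense in $Y$. Here $P\times P$ acts on $(A\times X)\times(A\times X)$. The measure-preserving system $(A,\mu,f)$ is weakly mixing if $\lim_{n}\frac1n\sum_{i=0}^{n-1}|\mu(f^{-i}(B)\cap C)-\mu(B)\mu(C)|=0$ for all Borel $B,C\subset A$. $\mu$ has full support if $\mu(U)>0$ for every nonempty open $U$. A sequence $(n_k)$ is syndetic if there is $M\in\mathbb{N}$ such that $\{n,n+1,\dots,n+M\}$ contains some $n_k$ for every $n\in\mathbb{Z}_+$. The maps $S_{n_k}$ are arbitrary maps. *)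

theory Defs
  imports "HOL-Analysis.Analysis" "HOL-Probability.Probability"
begin

text \<open>Complex Banach spaces. The complex scalar multiplication extends the real one
  underlying the class \<open>banach\<close>, so that norm, metric and topology are those of the library.\<close>

class complex_banach = banach +
  fixes scaleC :: "complex \<Rightarrow> 'a \<Rightarrow> 'a" (infixr "*\<^sub>C" 75)
  assumes scaleC_add_right: "c *\<^sub>C (x + y) = c *\<^sub>C x + c *\<^sub>C y"
    and scaleC_add_left: "(c + d) *\<^sub>C x = c *\<^sub>C x + d *\<^sub>C x"
    and scaleC_scaleC: "c *\<^sub>C d *\<^sub>C x = (c * d) *\<^sub>C x"
    and scaleC_one: "1 *\<^sub>C x = x"
    and scaleC_of_real: "complex_of_real r *\<^sub>C x = r *\<^sub>R x"
    and norm_scaleC: "norm (c *\<^sub>C x) = cmod c * norm x"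

instantiation complex :: complex_banach
begin

definition scaleC_complex :: "complex \<Rightarrow> complex \<Rightarrow> complex"
  where "scaleC_complex c x = c * x"

instance
  by standard (auto simp: scaleC_complex_def algebra_simps scaleR_conv_of_real norm_mult)

end

lemma vector_space_scaleC: "vector_space (scaleC :: complex \<Rightarrow> 'a \<Rightarrow> 'a::complex_banach)"
  by (unfold_locales) (simp_all add: scaleC_add_right scaleC_add_left scaleC_scaleC scaleC_one)

definition infinite_dimensional :: "'x::complex_banach itself \<Rightarrow> bool"
  where "infinite_dimensional _ \<longleftrightarrow>
    (\<nexists>B :: 'x set. finite B \<and> module.span (scaleC :: complex \<Rightarrow> 'x \<Rightarrow> 'x) B = UNIV)"

definition bounded_clinear :: "('x::complex_banach \<Rightarrow> 'y::complex_banach) \<Rightarrow> bool"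
  where "bounded_clinear T \<longleftrightarrow> bounded_linear T \<and> (\<forall>c x. T (c *\<^sub>C x) = c *\<^sub>C T x)"

definition topologically_transitive :: "('y::topological_space \<Rightarrow> 'y) \<Rightarrow> bool"
  where "topologically_transitive S \<longleftrightarrow> continuous_on UNIV S \<and>
    (\<forall>U V. open U \<and> U \<noteq> {} \<and> open V \<and> V \<noteq> {} \<longrightarrow>
      (\<exists>n\<ge>1. (S ^^ n) ` U \<inter> V \<noteq> {}))"

definition topologically_weakly_mixing :: "('y::topological_space \<Rightarrow> 'y) \<Rightarrow> bool"
  where "topologically_weakly_mixing S \<longleftrightarrow> topologically_transitive (map_prod S S)"

definition transitive_points :: "('y::topological_space \<Rightarrow> 'y) \<Rightarrow> 'y set"
  where "transitive_points S = {y. closure {(S ^^ n) y | n. True} = UNIV}"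

definition full_support :: "'a::topological_space measure \<Rightarrow> bool"
  where "full_support \<mu> \<longleftrightarrow> (\<forall>U. open U \<and> U \<noteq> {} \<longrightarrow> measure \<mu> U > 0)"

definition measure_preserving :: "'a measure \<Rightarrow> ('a \<Rightarrow> 'a) \<Rightarrow> bool"
  where "measure_preserving \<mu> f \<longleftrightarrow> f \<in> measurable \<mu> \<mu> \<and> distr \<mu> \<mu> f = \<mu>"

definition measure_weakly_mixing :: "'a measure \<Rightarrow> ('a \<Rightarrow> 'a) \<Rightarrow> bool"
  where "measure_weakly_mixing \<mu> f \<longleftrightarrow> measure_preserving \<mu> f \<and>
    (\<forall>B\<in>sets \<mu>. \<forall>C\<in>sets \<mu>.
      (\<lambda>n. (\<Sum>i<n. \<bar>measure \<mu> ((f ^^ i) -` B \<inter> C) - measure \<mu> B * measure \<mu> C\<bar>) / real n)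
        \<longlonglongrightarrow> 0)"

text \<open>\<open>\<integral> log |h| d\<mu>\<close> is the finite number \<open>\<gamma>\<close>. Mathematically \<open>log 0 = -\<infinity>\<close>, so a finite
  integral forces \<open>h \<noteq> 0\<close> almost everywhere; since \<open>ln 0 = 0\<close> in HOL, this has to be
  demanded separately.\<close>

definition has_log_integral :: "'a measure \<Rightarrow> ('a \<Rightarrow> complex) \<Rightarrow> real \<Rightarrow> bool"
  where "has_log_integral \<mu> h \<gamma> \<longleftrightarrow>
    (AE a in \<mu>. h a \<noteq> 0) \<and> has_bochner_integral \<mu> (\<lambda>a. ln (cmod (h a))) \<gamma>"

definition syndetic :: "(nat \<Rightarrow> nat) \<Rightarrow> bool"
  where "syndetic n \<longleftrightarrow> (\<exists>M. \<forall>m. \<exists>k. n k \<in> {m..m + M})"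

definition skew_product ::
  "('a \<Rightarrow> 'a) \<Rightarrow> ('a \<Rightarrow> complex) \<Rightarrow> ('x \<Rightarrow> 'x) \<Rightarrow> 'a \<times> 'x \<Rightarrow> 'a \<times> 'x::complex_banach"
  where "skew_product f h T = (\<lambda>(a, x). (f a, h a *\<^sub>C T x))"

end

theory Submission
  imports Defs
begin

text \<open>
  Write \<open>P\<^sup>m (a, x) = (f\<^sup>m a, h\<^sub>m(a) T\<^sup>m x)\<close> with the cocycle \<open>h\<^sub>m(a) = h(a) h(f a) \<cdots> h(f\<^sup>m\<^sup>-\<^sup>1 a)\<close>.
  No pointwise ergodic theorem is needed: under weak mixing a second moment estimate gives
  \<open>(log |h\<^sub>m|) / m \<rightarrow> \<gamma>\<close> in probability. Let \<open>N\<close> be the set of pairs \<open>(a, b)\<close> for which no large time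
  \<open>m = n\<^sub>k\<close> brings \<open>a\<close> into \<open>U\<close> and \<open>b\<close> into \<open>V\<close> with both cocycles growing at a rate close to \<open>\<gamma>\<close>.
  Since \<open>f \<times> f\<close> mixes \<open>N\<close> with \<open>U \<times> V\<close> along most times and a syndetic sequence cannot avoid
  most times, \<open>N\<close> is a null set. For \<open>(a, b)\<close> outside countably many such null sets, the vectors
  \<open>u = x + h\<^sub>m(a)\<^sup>-\<^sup>1 S\<^sub>m y\<close> are close to \<open>x\<close> with \<open>h\<^sub>m(a) T\<^sup>m u\<close> close to \<open>y\<close>, so the Baire category theorem
  in \<open>X \<times> X\<close> yields a transitive point over \<open>(a, b)\<close>. A transitive point in a space without isolated
  points makes \<open>P \<times> P\<close> topologically transitive.
\<close>

section \<open>Syndetic sequences and Cesaro means\<close>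

text \<open>If all \<open>c (n k)\<close> with \<open>k \<ge> K\<close> were at least
  \<open>\<epsilon>\<close>, every window of \<open>M + 1\<close> consecutive indices from
  \<open>n K\<close> on would contain such an index, and the Cesaro means would stay above a
  positive constant.\<close>

lemma cesaro_null_syndetic:
  fixes c :: "nat \<Rightarrow> real"
  assumes nonneg: "\<And>i. c i \<ge> 0"
    and lim: "(\<lambda>N. (\<Sum>i<N. c i) / real N) \<longlonglongrightarrow> 0"
    and n: "strict_mono n" "syndetic n"
    and "\<epsilon> > 0"
  shows "\<exists>k\<ge>K. c (n k) < \<epsilon>"
proof (rule ccontr)
  assume "\<not> ?thesis"
  then have large: "c (n k) \<ge> \<epsilon>" if "k \<ge> K" for k
    using that by (meson not_less)
  obtain M where M: "\<And>m. \<exists>k. n k \<in> {m..m + M}"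
    using n(2) by (auto simp: syndetic_def)
  have window: "(\<Sum>i\<in>{m..<m + Suc M}. c i) \<ge> \<epsilon>" if "m \<ge> n K" for m
  proof -
    obtain k where k: "n k \<in> {m..m + M}"
      using M by blast
    then have "k \<ge> K"
      using that n(1) by (meson atLeastAtMost_iff order.trans strict_mono_less_eq)
    then have "\<epsilon> \<le> c (n k)"
      by (rule large)
    also have "\<dots> \<le> (\<Sum>i\<in>{m..<m + Suc M}. c i)"
      using k nonneg by (intro member_le_sum) auto
    finally show ?thesis .
  qed
  have windows: "(\<Sum>i<n K + q * Suc M. c i) \<ge> real q * \<epsilon>" for q
  proof (induction q)
    case 0
    show ?case by (simp add: sum_nonneg nonneg)
  next
    case (Suc q)
    have "(\<Sum>i<n K + q * Suc M + Suc M. c i)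
        = (\<Sum>i<n K + q * Suc M. c i) + (\<Sum>i\<in>{n K + q * Suc M..<n K + q * Suc M + Suc M}. c i)"
      unfolding lessThan_atLeast0 by (rule sum.atLeastLessThan_concat[symmetric]) simp_all
    with Suc window[of "n K + q * Suc M"] show ?case
      by (simp add: algebra_simps)
  qed
  have "filterlim (\<lambda>q. n K + q * Suc M) at_top sequentially"
    by (rule filterlim_at_top_mono[OF filterlim_ident]) (intro always_eventually allI, simp)
  then have "(\<lambda>q. (\<Sum>i<n K + q * Suc M. c i) / real (n K + q * Suc M)) \<longlonglongrightarrow> 0"
    by (rule filterlim_compose[OF lim])
  \<comment> \<open>For \<open>q > n K\<close> the initial block of length \<open>n K\<close> is
    paid for by one extra unit per window, hence \<open>M + 2\<close> instead of
    \<open>M + 1\<close>.\<close>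
  moreover have "\<epsilon> / real (M + 2) \<le> (\<Sum>i<n K + q * Suc M. c i) / real (n K + q * Suc M)"
    if "q \<ge> Suc (n K)" for q
  proof -
    have "n K + q * Suc M \<le> q * (M + 2)"
      using that by simp
    then have "real (n K + q * Suc M) \<le> real q * real (M + 2)"
      by (metis of_nat_le_iff of_nat_mult)
    then have "real q * \<epsilon> / (real q * real (M + 2)) \<le> real q * \<epsilon> / real (n K + q * Suc M)"
      using that \<open>\<epsilon> > 0\<close> by (intro divide_left_mono mult_pos_pos) (simp_all add: add_nonneg_pos add_pos_nonneg)
    also have "\<dots> \<le> (\<Sum>i<n K + q * Suc M. c i) / real (n K + q * Suc M)"
      by (intro divide_right_mono windows) simp
    finally show ?thesis
      using that by simp
  qed
  ultimately have "\<epsilon> / real (M + 2) \<le> 0"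
    by (blast intro: LIMSEQ_le_const)
  with \<open>\<epsilon> > 0\<close> show False
    by (simp add: divide_le_0_iff)
qed

text \<open>The null sequence \<open>v\<close> may depend on \<open>e\<close>; this form suits
  truncation arguments whose error is uniform in \<open>n\<close>.\<close>

lemma null_sequence_approx:
  fixes u :: "nat \<Rightarrow> real"
  assumes "\<And>e. e > 0 \<Longrightarrow> \<exists>v. v \<longlonglongrightarrow> 0 \<and> (\<forall>n. \<bar>u n\<bar> \<le> v n + e)"
  shows "u \<longlonglongrightarrow> 0"
proof (rule LIMSEQ_I)
  fix e :: real assume "e > 0"
  then obtain v where v: "v \<longlonglongrightarrow> 0" "\<And>n. \<bar>u n\<bar> \<le> v n + e / 2"
    using assms[of "e / 2"] by auto
  obtain n0 where n0: "\<And>n. n \<ge> n0 \<Longrightarrow> norm (v n - 0) < e / 2"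
    using LIMSEQ_D[OF v(1), of "e / 2"] \<open>e > 0\<close> by auto
  have "norm (u n - 0) < e" if "n \<ge> n0" for n
    using v(2)[of n] n0[OF that] unfolding real_norm_def by linarith
  then show "\<exists>n0. \<forall>n\<ge>n0. norm (u n - 0) < e"
    by blast
qed

section \<open>Weakly mixing systems\<close>

locale weakly_mixing_system = prob_space M for M :: "'a measure" +
  fixes f :: "'a \<Rightarrow> 'a"
  assumes weakly_mixing: "measure_weakly_mixing M f"
begin

lemma measurable_iterate [measurable]: "f ^^ i \<in> measurable M M"
  using weakly_mixing
  by (intro measurable_compose_n) (auto simp: measure_weakly_mixing_def measure_preserving_def)

lemma distr_iterate: "distr M M (f ^^ i) = M"
proof (induction i)
  case (Suc i)
  have f: "f \<in> measurable M M" "distr M M f = M"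
    using weakly_mixing by (auto simp: measure_weakly_mixing_def measure_preserving_def)
  have "distr M M (f ^^ Suc i) = distr (distr M M (f ^^ i)) M f"
    by (subst distr_distr) (auto simp: f)
  with Suc f show ?case by (simp only:)
qed (auto intro: distr_id)

lemma integral_iterate:
  fixes g :: "'a \<Rightarrow> real"
  assumes [measurable]: "g \<in> borel_measurable M"
  shows "(\<integral>x. g ((f ^^ i) x) \<partial>M) = (\<integral>x. g x \<partial>M)"
  by (subst (2) distr_iterate[of i, symmetric]) (simp add: integral_distr)

lemma integrable_iterate:
  fixes g :: "'a \<Rightarrow> real"
  assumes "integrable M g"
  shows "integrable M (\<lambda>x. g ((f ^^ i) x))"
  using assms by (intro integrable_distr[of "f ^^ i" M M g]) (simp_all add: distr_iterate)

lemma AE_iterate: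
  assumes "AE x in M. Q x"
  shows "AE x in M. Q ((f ^^ i) x)"
  by (rule AE_distrD[OF measurable_iterate]) (unfold distr_iterate, rule assms)

section \<open>Convergence of Birkhoff averages in L1 and in probability\<close>

lemma mixing_lim:
  assumes "B \<in> sets M" "C \<in> sets M"
  shows "(\<lambda>n. (\<Sum>i<n. \<bar>prob ((f ^^ i) -` B \<inter> C) - prob B * prob C\<bar>) / real n) \<longlonglongrightarrow> 0"
  using assms weakly_mixing by (auto simp: measure_weakly_mixing_def)

text \<open>Second moment method: the covariance of the centred indicators at two times depends only
  on the time difference \<open>d\<close> and equals \<open>r d\<close>. Weak mixing of
  \<open>B\<close> with itself sends the Cesaro means of the absolute values of \<open>r\<close> to
  0, so the variance of the sum of \<open>n\<close> terms is o(n^2).\<close>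

lemma mean_ergodic_indicator:
  assumes B [measurable]: "B \<in> sets M"
  shows "(\<lambda>n. (\<integral>x. \<bar>(\<Sum>i<n. indicator B ((f ^^ i) x)) - real n * prob B\<bar> \<partial>M) / real n) \<longlonglongrightarrow> 0"
proof -
  define a where "a i x = indicator B ((f ^^ i) x) - prob B" for i x
  define r where "r d = prob ((f ^^ d) -` B \<inter> B) - prob B * prob B" for d
  define R where "R n = (\<Sum>d<n. \<bar>r d\<bar>)" for n
  have a_meas [measurable]: "a i \<in> borel_measurable M" for i
    unfolding a_def by measurable
  have a_bound: "\<bar>a i x\<bar> \<le> 1" for i x
    by (auto simp: a_def indicator_def)
  have aa_int: "integrable M (\<lambda>x. a i x * a j x)" for i j
    by (rule integrable_const_bound[where B = 1])
       (auto simp: abs_mult intro!: mult_le_one a_bound)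
  have a_int: "integrable M (a i)" for i
    by (rule integrable_const_bound[where B = 1]) (auto intro!: a_bound)
  have exp_a: "expectation (a i) = 0" for i
  proof -
    have "expectation (a i) = expectation (a 0)"
      using integral_iterate[of "a 0" i] unfolding a_def by simp
    also have "\<dots> = 0"
      unfolding a_def
      by (subst Bochner_Integration.integral_diff) (auto simp: prob_space less_top[symmetric])
    finally show ?thesis .
  qed
  have corr: "expectation (\<lambda>x. a i x * a (i + d) x) = r d" for i d
  proof -
    have "expectation (\<lambda>x. a i x * a (i + d) x) = expectation (\<lambda>x. a 0 x * a d x)"
      using integral_iterate[of "\<lambda>x. a 0 x * a d x" i]
      by (simp add: a_def add.commute funpow_add)
    \<comment> \<open>The product is expanded in centred terms, so that the two linear ones
      integrate to 0.\<close>
    also have "\<dots> = expectation (\<lambda>x. indicator ((f ^^ d) -` B \<inter> B) x - prob B * a 0 x - prob B * a d x - prob B * prob B)"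
      by (intro Bochner_Integration.integral_cong) (auto simp: a_def indicator_def algebra_simps)
    also have "\<dots> = r d"
    proof -
      \<comment> \<open>The preimage is taken in the whole type; the intersection is measurable
        because \<open>B\<close> lies in \<open>space M\<close>.\<close>
      have [measurable]: "(f ^^ d) -` B \<inter> B \<in> sets M"
      proof -
        have "(f ^^ d) -` B \<inter> B = ((f ^^ d) -` B \<inter> space M) \<inter> B"
          using sets.sets_into_space[OF B] by auto
        then show ?thesis
          using measurable_sets[OF measurable_iterate B] by auto
      qed
      then show ?thesis
        by (simp add: a_int exp_a r_def prob_space less_top[symmetric] del: sets.Int)
    qed
    finally show ?thesis .
  qed
  define Q where "Q n = expectation (\<lambda>x. (\<Sum>i<n. a i x)\<^sup>2)" for n
  have sq_int: "integrable M (\<lambda>x. (\<Sum>i<n. a i x)\<^sup>2)" for n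
    by (simp add: power2_eq_square sum_product aa_int)
  \<comment> \<open>Passing from \<open>n\<close> to \<open>Suc n\<close> adds the diagonal term
    \<open>r 0\<close> and, twice each, the terms \<open>r d\<close> with \<open>d\<close> from 1 to
    \<open>n\<close>. Together they are at most \<open>2 * R (Suc n)\<close>, and \<open>R\<close>
    is monotone.\<close>
  have Q_le: "Q n \<le> 2 * real n * R n" for n
  proof (induction n)
    case (Suc n)
    have "Q (Suc n) = expectation (\<lambda>x. (\<Sum>i<n. a i x)\<^sup>2 + 2 * (\<Sum>i<n. a i x * a n x) + a n x * a n x)"
      unfolding Q_def
      by (intro Bochner_Integration.integral_cong)
         (auto simp: power2_eq_square algebra_simps sum_distrib_left)
    also have "\<dots> = Q n + 2 * (\<Sum>i<n. expectation (\<lambda>x. a i x * a n x)) + expectation (\<lambda>x. a n x * a n x)"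
      unfolding Q_def by (simp add: sq_int aa_int)
    also have "(\<Sum>i<n. expectation (\<lambda>x. a i x * a n x)) = (\<Sum>i<n. r (n - i))"
      by (intro sum.cong refl) (use corr in \<open>metis lessThan_iff less_imp_le le_add_diff_inverse\<close>)
    also have "\<dots> = (\<Sum>d<n. r (Suc d))"
      by (rule sum.reindex_bij_witness[where i = "\<lambda>d. n - Suc d" and j = "\<lambda>i. n - Suc i"])
         (auto simp: Suc_diff_Suc)
    also have "expectation (\<lambda>x. a n x * a n x) = r 0"
      using corr[of n 0] by simp
    also have "Q n + 2 * (\<Sum>d<n. r (Suc d)) + r 0 \<le> Q n + 2 * R (Suc n)"
    proof -
      have "(\<Sum>d<n. r (Suc d)) \<le> (\<Sum>d<n. \<bar>r (Suc d)\<bar>)"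
        by (intro sum_mono) auto
      moreover have "R (Suc n) = \<bar>r 0\<bar> + (\<Sum>d<n. \<bar>r (Suc d)\<bar>)"
        unfolding R_def by (rule sum.lessThan_Suc_shift)
      ultimately show ?thesis by linarith
    qed
    also have "\<dots> \<le> 2 * real n * R (Suc n) + 2 * R (Suc n)"
      using Suc mult_left_mono[of "R n" "R (Suc n)" "2 * real n"] by (simp add: R_def)
    finally show ?case by (simp add: algebra_simps)
  qed (simp add: Q_def)
  \<comment> \<open>Cauchy-Schwarz, in the form that the variance of the absolute value is
    nonnegative.\<close>
  have E_sq: "(expectation (\<lambda>x. \<bar>\<Sum>i<n. a i x\<bar>))\<^sup>2 \<le> Q n" for n
  proof -
    have "integrable M (\<lambda>x. \<bar>\<Sum>i<n. a i x\<bar>)"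
      using a_int by auto
    then have "variance (\<lambda>x. \<bar>\<Sum>i<n. a i x\<bar>) = Q n - (expectation (\<lambda>x. \<bar>\<Sum>i<n. a i x\<bar>))\<^sup>2"
      unfolding Q_def by (subst variance_eq) (auto simp: sq_int)
    then show ?thesis
      using variance_positive[of "\<lambda>x. \<bar>\<Sum>i<n. a i x\<bar>"] by linarith
  qed
  \<comment> \<open>The case \<open>n = 0\<close> is included: division by zero yields 0, so both
    sides vanish.\<close>
  have "expectation (\<lambda>x. \<bar>\<Sum>i<n. a i x\<bar>) / real n \<le> sqrt (2 * (R n / real n))" for n
  proof (rule real_le_rsqrt)
    have "(expectation (\<lambda>x. \<bar>\<Sum>i<n. a i x\<bar>) / real n)\<^sup>2 \<le> 2 * real n * R n / (real n)\<^sup>2"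
      unfolding power_divide by (intro divide_right_mono order.trans[OF E_sq Q_le]) auto
    also have "\<dots> = 2 * (R n / real n)"
      by (simp add: power2_eq_square)
    finally show "(expectation (\<lambda>x. \<bar>\<Sum>i<n. a i x\<bar>) / real n)\<^sup>2 \<le> 2 * (R n / real n)" .
  qed
  moreover have "(\<lambda>n. sqrt (2 * (R n / real n))) \<longlonglongrightarrow> 0"
    using tendsto_real_sqrt[OF tendsto_mult_left[OF mixing_lim[OF B B], of 2]]
    by (simp add: R_def r_def)
  ultimately have "(\<lambda>n. expectation (\<lambda>x. \<bar>\<Sum>i<n. a i x\<bar>) / real n) \<longlonglongrightarrow> 0"
    by - (rule Lim_null_comparison[OF always_eventually], auto)
  then show ?thesis
    by (simp add: a_def sum_subtractf)
qed

text \<open>The claim passes from indicators to sums and to L1 limits, since composition with an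
  iterate of \<open>f\<close> preserves the L1 norm and the error is therefore uniform in
  \<open>n\<close>.\<close>

lemma mean_ergodic:
  fixes g :: "'a \<Rightarrow> real"
  assumes "integrable M g"
  shows "(\<lambda>n. (\<integral>x. \<bar>(\<Sum>i<n. g ((f ^^ i) x)) - real n * expectation g\<bar> \<partial>M) / real n) \<longlonglongrightarrow> 0"
  using assms
proof (induct rule: integrable_induct)
  case (base A c)
  have *: "(\<Sum>i<n. indicator A ((f ^^ i) x) * c) - real n * (prob A * c)
      = c * ((\<Sum>i<n. indicator A ((f ^^ i) x)) - real n * prob A)" for n and x :: 'a
    by (simp add: sum_distrib_left algebra_simps)
  have "(\<integral>x. \<bar>(\<Sum>i<n. indicator A ((f ^^ i) x) *\<^sub>R c) - real n * expectation (\<lambda>x. indicator A x *\<^sub>R c)\<bar> \<partial>M) / real n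
      = \<bar>c\<bar> * ((\<integral>x. \<bar>(\<Sum>i<n. indicator A ((f ^^ i) x)) - real n * prob A\<bar> \<partial>M) / real n)" for n
  proof -
    have "expectation (\<lambda>x. indicator A x *\<^sub>R c) = prob A * c"
      using base by simp
    then show ?thesis
      by (simp only: real_scaleR_def * abs_mult integral_mult_right_zero times_divide_eq_right)
  qed
  then show ?case
    using tendsto_mult_left[OF mean_ergodic_indicator[OF base(1)], of "\<bar>c\<bar>"]
    by (simp only: mult_zero_right)
next
  case (add g g')
  note [simp] = integrable_iterate[OF add(1)] integrable_iterate[OF add(3)] add(1,3)
  let ?D = "\<lambda>g n x. (\<Sum>i<n. g ((f ^^ i) x)) - real n * expectation g"
  let ?E = "\<lambda>g n. (\<integral>x. \<bar>?D g n x\<bar> \<partial>M) / real n"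
  have D_add: "?D (\<lambda>x. g x + g' x) n x = ?D g n x + ?D g' n x" for n x
    by (simp add: sum.distrib ring_distribs)
  have "?E (\<lambda>x. g x + g' x) n \<le> ?E g n + ?E g' n" for n
  proof -
    have "(\<integral>x. \<bar>?D g n x + ?D g' n x\<bar> \<partial>M) \<le> (\<integral>x. \<bar>?D g n x\<bar> + \<bar>?D g' n x\<bar> \<partial>M)"
      by (intro integral_mono) auto
    also have "\<dots> = (\<integral>x. \<bar>?D g n x\<bar> \<partial>M) + (\<integral>x. \<bar>?D g' n x\<bar> \<partial>M)"
      by (intro Bochner_Integration.integral_add) auto
    finally show ?thesis
      unfolding D_add add_divide_distrib[symmetric] by (rule divide_right_mono) simp
  qed
  then have "\<forall>\<^sub>F n in sequentially. norm (?E (\<lambda>x. g x + g' x) n) \<le> ?E g n + ?E g' n"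
    by (intro always_eventually) simp
  then show ?case
    by (rule Lim_null_comparison) (use tendsto_add[OF add(2,4)] in simp)
next
  case (lim g s)
  let ?E = "\<lambda>g n. (\<integral>x. \<bar>(\<Sum>i<n. g ((f ^^ i) x)) - real n * expectation g\<bar> \<partial>M) / real n"
  have g_meas [measurable]: "g \<in> borel_measurable M" and s_meas [measurable]: "s i \<in> borel_measurable M" for i
    using lim by auto
  note [simp] = integrable_iterate[OF lim(1)] integrable_iterate[OF lim(5)] lim(1,5)
  \<comment> \<open>The approximants satisfy \<open>norm (s j x) \<le> 2 * norm (g x)\<close>, so
    \<open>3 * norm (g x)\<close> dominates the difference.\<close>
  have "(\<lambda>j. expectation (\<lambda>x. \<bar>g x - s j x\<bar>)) \<longlonglongrightarrow> expectation (\<lambda>x. 0)"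
  proof (rule integral_dominated_convergence)
    show "AE x in M. (\<lambda>j. \<bar>g x - s j x\<bar>) \<longlonglongrightarrow> 0"
      using lim(3) by (auto intro!: AE_I2 tendsto_eq_intros)
    show "AE x in M. norm \<bar>g x - s j x\<bar> \<le> 3 * norm (g x)" for j
    proof (rule AE_I2)
      fix x assume "x \<in> space M"
      from lim(4)[OF this, of j] show "norm \<bar>g x - s j x\<bar> \<le> 3 * norm (g x)" by auto
    qed
  qed auto
  then have approx: "(\<lambda>j. expectation (\<lambda>x. \<bar>g x - s j x\<bar>)) \<longlonglongrightarrow> 0"
    by simp
  \<comment> \<open>The L1 distance of \<open>g\<close> and \<open>s j\<close> enters twice: through
    the Birkhoff sums, where invariance gives all \<open>n\<close> terms the same integral, and
    through the two means.\<close>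
  have diff: "?E g n \<le> ?E (s j) n + 2 * expectation (\<lambda>x. \<bar>g x - s j x\<bar>)" for n j
  proof (cases "n = 0")
    case False
    let ?d = "expectation (\<lambda>x. \<bar>g x - s j x\<bar>)"
    have d: "\<bar>expectation g - expectation (s j)\<bar> \<le> ?d"
      using integral_abs_bound[of M "\<lambda>x. g x - s j x"] by simp
    have "(\<integral>x. \<bar>(\<Sum>i<n. g ((f ^^ i) x)) - real n * expectation g\<bar> \<partial>M)
      \<le> (\<integral>x. \<bar>(\<Sum>i<n. s j ((f ^^ i) x)) - real n * expectation (s j)\<bar>
          + (\<Sum>i<n. \<bar>g ((f ^^ i) x) - s j ((f ^^ i) x)\<bar>) + real n * ?d \<partial>M)"
    proof (rule integral_mono)
      fix x
      have "\<bar>(\<Sum>i<n. g ((f ^^ i) x)) - (\<Sum>i<n. s j ((f ^^ i) x))\<bar> \<le> (\<Sum>i<n. \<bar>g ((f ^^ i) x) - s j ((f ^^ i) x)\<bar>)"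
        unfolding sum_subtractf[symmetric] by (rule sum_abs)
      moreover have "\<bar>real n * expectation (s j) - real n * expectation g\<bar> \<le> real n * ?d"
        using mult_left_mono[OF d, of "real n"]
        by (subst abs_minus_commute) (simp add: abs_mult flip: right_diff_distrib)
      ultimately show "\<bar>(\<Sum>i<n. g ((f ^^ i) x)) - real n * expectation g\<bar>
          \<le> \<bar>(\<Sum>i<n. s j ((f ^^ i) x)) - real n * expectation (s j)\<bar>
          + (\<Sum>i<n. \<bar>g ((f ^^ i) x) - s j ((f ^^ i) x)\<bar>) + real n * ?d"
        by linarith
    qed auto
    also have "\<dots> = (\<integral>x. \<bar>(\<Sum>i<n. s j ((f ^^ i) x)) - real n * expectation (s j)\<bar> \<partial>M) + 2 * real n * ?d"
      using integral_iterate[of "\<lambda>x. \<bar>g x - s j x\<bar>"] by (simp add: prob_space)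
    finally show ?thesis
      using False by (simp add: field_simps)
  qed simp
  show ?case
  proof (rule LIMSEQ_I)
    fix e :: real assume "e > 0"
    then obtain j where "norm (expectation (\<lambda>x. \<bar>g x - s j x\<bar>) - 0) < e / 4"
      using LIMSEQ_D[OF approx, of "e / 4"] by auto
    then have j: "expectation (\<lambda>x. \<bar>g x - s j x\<bar>) < e / 4"
      by simp
    obtain N where N: "\<And>n. n \<ge> N \<Longrightarrow> norm (?E (s j) n - 0) < e / 2"
      using LIMSEQ_D[OF lim(2)[of j], of "e / 2"] \<open>e > 0\<close> by auto
    have "norm (?E g n - 0) < e" if "n \<ge> N" for n
    proof -
      have "?E g n \<ge> 0" by simp
      then show ?thesis
        using diff[of n j] N[OF that] j unfolding real_norm_def by linarith
    qed
    then show "\<exists>N. \<forall>n\<ge>N. norm (?E g n - 0) < e" by blast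
  qed
qed

text \<open>Markov's inequality applied to the L1 convergence.\<close>

lemma mean_ergodic_in_probability:
  fixes g :: "'a \<Rightarrow> real"
  assumes "integrable M g" "\<epsilon> > 0"
  shows "(\<lambda>n. prob {x\<in>space M. \<bar>(\<Sum>i<n. g ((f ^^ i) x)) - real n * expectation g\<bar> \<ge> \<epsilon> * real n}) \<longlonglongrightarrow> 0"
proof -
  let ?E = "\<lambda>n. (\<integral>x. \<bar>(\<Sum>i<n. g ((f ^^ i) x)) - real n * expectation g\<bar> \<partial>M) / real n"
  have "prob {x\<in>space M. \<bar>(\<Sum>i<n. g ((f ^^ i) x)) - real n * expectation g\<bar> \<ge> \<epsilon> * real n} \<le> ?E n / \<epsilon>"
    if "n \<ge> 1" for n
  proof -
    have "prob {x\<in>space M. \<bar>(\<Sum>i<n. g ((f ^^ i) x)) - real n * expectation g\<bar> \<ge> \<epsilon> * real n}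
        \<le> (\<integral>x. \<bar>(\<Sum>i<n. g ((f ^^ i) x)) - real n * expectation g\<bar> \<partial>M) / (\<epsilon> * real n)"
      using assms that
      by (intro integral_Markov_inequality_measure[where A = "{}"]) (auto simp: integrable_iterate)
    then show ?thesis by (simp add: mult.commute)
  qed
  then have "\<forall>\<^sub>F n in sequentially.
      norm (prob {x\<in>space M. \<bar>(\<Sum>i<n. g ((f ^^ i) x)) - real n * expectation g\<bar> \<ge> \<epsilon> * real n}) \<le> ?E n / \<epsilon>"
    by (intro eventually_sequentiallyI[of 1]) simp
  then show ?thesis
    by (rule Lim_null_comparison)
       (use tendsto_divide[OF mean_ergodic[OF assms(1)] tendsto_const, of \<epsilon>] assms(2) in simp)
qed

section \<open>Mixing and return times for the product system\<close>

sublocale square: pair_prob_space M M ..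

lemma measure_square_Times:
  assumes "B \<in> sets M" "C \<in> sets M"
  shows "measure (M \<Otimes>\<^sub>M M) (B \<times> C) = prob B * prob C"
  using assms by (simp add: measure_def emeasure_pair_measure_Times enn2real_mult)

text \<open>The preimage of \<open>B \<times> C\<close> under the \<open>i\<close>-th iterate of the
  product map, kept as a rectangle so that its product measure factors.\<close>

definition return_set :: "'a set \<Rightarrow> 'a set \<Rightarrow> nat \<Rightarrow> ('a \<times> 'a) set"
  where "return_set B C i = ((f ^^ i) -` B \<inter> space M) \<times> ((f ^^ i) -` C \<inter> space M)"

lemma sets_return_set [measurable]:
  "B \<in> sets M \<Longrightarrow> C \<in> sets M \<Longrightarrow> return_set B C i \<in> sets (M \<Otimes>\<^sub>M M)"
  unfolding return_set_def by (intro pair_measureI measurable_sets[OF measurable_iterate])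

lemma prob_iterate_vimage:
  assumes "B \<in> sets M"
  shows "prob ((f ^^ i) -` B \<inter> space M) = prob B"
  using measure_distr[OF measurable_iterate[of i] assms] by (simp only: distr_iterate)

text \<open>For a rectangle \<open>N\<close> the correlation factors, and weak mixing applies in
  each coordinate. The sets \<open>N\<close> with the claimed limit are closed under complements and
  countable disjoint unions, so Dynkin's theorem extends the limit to the product sigma-algebra. The
  returning set stays a rectangle throughout.\<close>

lemma square_mixing:
  assumes B: "B \<in> sets M" and C: "C \<in> sets M" and N: "N \<in> sets (M \<Otimes>\<^sub>M M)"
  shows "(\<lambda>n. (\<Sum>i<n. \<bar>measure (M \<Otimes>\<^sub>M M) (return_set B C i \<inter> N)
      - prob B * prob C * measure (M \<Otimes>\<^sub>M M) N\<bar>) / real n) \<longlonglongrightarrow> 0"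
proof -
  let ?m = "measure (M \<Otimes>\<^sub>M M)" and ?\<Omega> = "space M \<times> space M"
  let ?r = "prob B * prob C"
  define d where "d N i = ?m (return_set B C i \<inter> N) - ?r * ?m N" for N i
  have R [measurable]: "return_set B C i \<in> sets (M \<Otimes>\<^sub>M M)" for i
    using B C by simp
  have m_R: "?m (return_set B C i) = ?r" for i
    unfolding return_set_def
    by (subst measure_square_Times)
       (auto intro!: measurable_sets[OF measurable_iterate] simp: B C prob_iterate_vimage)
  have r01: "0 \<le> ?r" "?r \<le> 1"
    by (auto intro: mult_le_one)
  have "(\<lambda>n. (\<Sum>i<n. \<bar>d N i\<bar>) / real n) \<longlonglongrightarrow> 0"
    using Int_stable_pair_measure_generator[of M M] pair_measure_closed[of M M] N
    unfolding sets_pair_measure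
  proof (induct rule: sigma_sets_induct_disjoint)
    case (basic N)
    then obtain D E where N: "N = D \<times> E" and D [measurable]: "D \<in> sets M" and E [measurable]: "E \<in> sets M"
      by blast
    let ?a = "\<lambda>i. prob ((f ^^ i) -` B \<inter> D)" and ?b = "\<lambda>i. prob ((f ^^ i) -` C \<inter> E)"
    have sets: "(f ^^ i) -` B' \<inter> D' \<in> sets M" if "B' \<in> sets M" "D' \<in> sets M" for B' D' i
    proof -
      have "(f ^^ i) -` B' \<inter> D' = ((f ^^ i) -` B' \<inter> space M) \<inter> D'"
        using sets.sets_into_space[OF that(2)] by auto
      then show ?thesis
        using measurable_sets[OF measurable_iterate that(1)] that(2) by auto
    qed
    have "\<bar>d N i\<bar> \<le> \<bar>?a i - prob B * prob D\<bar> + \<bar>?b i - prob C * prob E\<bar>" for i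
    proof -
      have "return_set B C i \<inter> N = ((f ^^ i) -` B \<inter> D) \<times> ((f ^^ i) -` C \<inter> E)"
        using sets.sets_into_space[OF D] sets.sets_into_space[OF E]
        by (auto simp: return_set_def N)
      then have "d N i = ?a i * ?b i - prob B * prob C * (prob D * prob E)"
        by (simp add: d_def N measure_square_Times sets B C)
      \<comment> \<open>The difference of products is split so that only one factor changes at a
        time; the remaining factors are probabilities, hence at most 1.\<close>
      also have "\<dots> = (?a i - prob B * prob D) * ?b i + (prob B * prob D) * (?b i - prob C * prob E)"
        by (simp add: algebra_simps)
      also have "\<bar>\<dots>\<bar> \<le> \<bar>?a i - prob B * prob D\<bar> * ?b i + (prob B * prob D) * \<bar>?b i - prob C * prob E\<bar>"
        by (rule order.trans[OF abs_triangle_ineq]) (simp add: abs_mult)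
      also have "\<dots> \<le> \<bar>?a i - prob B * prob D\<bar> * 1 + 1 * \<bar>?b i - prob C * prob E\<bar>"
        by (intro add_mono mult_left_mono mult_right_mono mult_le_one) auto
      finally show ?thesis by simp
    qed
    then have "(\<Sum>i<n. \<bar>d N i\<bar>) / real n \<le> (\<Sum>i<n. \<bar>?a i - prob B * prob D\<bar>) / real n
        + (\<Sum>i<n. \<bar>?b i - prob C * prob E\<bar>) / real n" for n
      unfolding add_divide_distrib[symmetric] sum.distrib[symmetric]
      by (intro divide_right_mono sum_mono) auto
    then have "\<forall>\<^sub>F n in sequentially. norm ((\<Sum>i<n. \<bar>d N i\<bar>) / real n)
        \<le> (\<Sum>i<n. \<bar>?a i - prob B * prob D\<bar>) / real n + (\<Sum>i<n. \<bar>?b i - prob C * prob E\<bar>) / real n"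
      by (intro always_eventually) (simp add: sum_nonneg)
    then show ?case
      by (rule Lim_null_comparison) (use tendsto_add[OF mixing_lim[OF B D] mixing_lim[OF C E]] in simp)
  next
    case empty
    show ?case by (simp add: d_def)
  next
    case (compl N)
    then have N [measurable]: "N \<in> sets (M \<Otimes>\<^sub>M M)"
      by (simp add: sets_pair_measure)
    \<comment> \<open>By invariance the return set has measure \<open>?r\<close>, so taking
      complements only flips the sign of \<open>d\<close>.\<close>
    have "d (?\<Omega> - N) i = - d N i" for i
    proof -
      have m_compl: "?m (?\<Omega> - N) = 1 - ?m N"
        using square.prob_compl[OF N] by (simp add: space_pair_measure)
      have "return_set B C i \<inter> (?\<Omega> - N) = return_set B C i - (return_set B C i \<inter> N)"
        by (auto simp: return_set_def)
      then have m_R_compl: "?m (return_set B C i \<inter> (?\<Omega> - N)) = ?r - ?m (return_set B C i \<inter> N)"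
        by (simp add: square.finite_measure_Diff m_R)
      show ?thesis
        unfolding d_def m_compl m_R_compl by (simp add: algebra_simps)
    qed
    with compl show ?case by simp
  next
    case (union A)
    then have A [measurable]: "A j \<in> sets (M \<Otimes>\<^sub>M M)" for j
      by (auto simp: sets_pair_measure)
    let ?V = "\<lambda>J. \<Union>j<J. A j" and ?U = "\<Union>j. A j"
    have d_V: "d (?V J) i = (\<Sum>j<J. d (A j) i)" for J i
    proof -
      have "?m (?V J) = (\<Sum>j<J. ?m (A j))"
        using union(1) by (intro square.finite_measure_finite_Union) (auto simp: disjoint_family_on_def)
      moreover have "?m (\<Union>j<J. return_set B C i \<inter> A j) = (\<Sum>j<J. ?m (return_set B C i \<inter> A j))"
        using union(1) by (intro square.finite_measure_finite_Union) (auto simp: disjoint_family_on_def)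
      ultimately show ?thesis
        by (simp add: d_def sum_subtractf sum_distrib_left)
    qed
    have V_lim: "(\<lambda>J. ?m (?V J)) \<longlonglongrightarrow> ?m (\<Union>J. ?V J)"
      by (intro square.finite_Lim_measure_incseq) (auto simp: incseq_def intro: less_le_trans)
    moreover have "(\<Union>J. ?V J) = ?U"
      by auto
    ultimately have V_lim: "(\<lambda>J. ?m (?V J)) \<longlonglongrightarrow> ?m ?U"
      by simp
    show ?case
    proof (rule null_sequence_approx)
      fix e :: real assume "e > 0"
      \<comment> \<open>The union is cut where the tail \<open>?W\<close> has measure below
        \<open>e\<close>. The tail then contributes less than \<open>e\<close> to \<open>d\<close>
        at every time \<open>i\<close>, and the first \<open>J\<close> sets are treated by finite
        additivity.\<close>
      then obtain J where "norm (?m (?V J) - ?m ?U) < e"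
        using LIMSEQ_D[OF V_lim] by blast
      then have J: "?m ?U - ?m (?V J) < e"
        by auto
      have "\<bar>d ?U i\<bar> \<le> (\<Sum>j<J. \<bar>d (A j) i\<bar>) + e" for i
      proof -
        let ?W = "?U - ?V J"
        have U: "?m ?U = ?m (?V J) + ?m ?W"
          by (subst square.finite_measure_Union[symmetric]) (auto intro!: arg_cong[of _ _ ?m])
        have RU: "?m (return_set B C i \<inter> ?U) = ?m (return_set B C i \<inter> ?V J) + ?m (return_set B C i \<inter> ?W)"
          by (subst square.finite_measure_Union[symmetric]) (auto intro!: arg_cong[of _ _ ?m])
        have "?m (return_set B C i \<inter> ?W) \<le> ?m ?W"
          by (intro square.finite_measure_mono) auto
        moreover have "?r * ?m ?W \<le> ?m ?W" "0 \<le> ?r * ?m ?W"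
          using r01 by (auto intro: mult_left_le_one_le)
        moreover have "d ?U i = d (?V J) i + (?m (return_set B C i \<inter> ?W) - ?r * ?m ?W)"
          by (simp only: d_def U RU ring_distribs)
        moreover have "0 \<le> ?m (return_set B C i \<inter> ?W)"
          by simp
        ultimately have "\<bar>d ?U i\<bar> \<le> \<bar>d (?V J) i\<bar> + e"
          using J U by linarith
        also have "\<bar>d (?V J) i\<bar> \<le> (\<Sum>j<J. \<bar>d (A j) i\<bar>)"
          unfolding d_V by (rule sum_abs)
        finally show ?thesis by simp
      qed
      then have *: "(\<Sum>i<n. \<bar>d ?U i\<bar>) \<le> (\<Sum>i<n. (\<Sum>j<J. \<bar>d (A j) i\<bar>) + e)" for n
        by (intro sum_mono)
      have "\<bar>(\<Sum>i<n. \<bar>d ?U i\<bar>) / real n\<bar> \<le> (\<Sum>j<J. (\<Sum>i<n. \<bar>d (A j) i\<bar>) / real n) + e" for n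
      proof (cases "n = 0")
        case False
        have "(\<Sum>i<n. \<bar>d ?U i\<bar>) \<le> (\<Sum>j<J. \<Sum>i<n. \<bar>d (A j) i\<bar>) + real n * e"
          using *[of n] sum.swap[of "\<lambda>i j. \<bar>d (A j) i\<bar>" "{..<J}" "{..<n}"] by (simp add: sum.distrib)
        then have "(\<Sum>i<n. \<bar>d ?U i\<bar>) / real n \<le> ((\<Sum>j<J. \<Sum>i<n. \<bar>d (A j) i\<bar>) + real n * e) / real n"
          by (rule divide_right_mono) simp
        also have "\<dots> = (\<Sum>j<J. (\<Sum>i<n. \<bar>d (A j) i\<bar>) / real n) + e"
          using False by (simp add: add_divide_distrib sum_divide_distrib)
        finally show ?thesis
          by (simp add: sum_nonneg)
      qed (use \<open>e > 0\<close> in simp)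
      moreover have "(\<lambda>n. \<Sum>j<J. (\<Sum>i<n. \<bar>d (A j) i\<bar>) / real n) \<longlonglongrightarrow> (\<Sum>j<J. 0)"
        by (intro tendsto_sum union)
      ultimately show "\<exists>v. v \<longlonglongrightarrow> 0 \<and> (\<forall>n. \<bar>(\<Sum>i<n. \<bar>d ?U i\<bar>) / real n\<bar> \<le> v n + e)"
        by auto
    qed
  qed
  then show ?thesis
    unfolding d_def .
qed

text \<open>On the exceptional set \<open>N\<close> a return at a time \<open>n k\<close> with
  \<open>k \<ge> K\<close> can happen only inside \<open>Z2 (n k)\<close>, whose measure tends to 0.
  If \<open>N\<close> had positive measure, mixing along the syndetic sequence would give returns
  from \<open>N\<close> of measure bounded below at some late time.\<close>

lemma AE_simultaneous_return:
  assumes B: "B \<in> sets M" "prob B > 0" and C: "C \<in> sets M" "prob C > 0"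
    and Z: "\<And>i. Z i \<in> sets M" "(\<lambda>i. prob (Z i)) \<longlonglongrightarrow> 0"
    and n: "strict_mono n" "syndetic n"
  shows "AE p in M \<Otimes>\<^sub>M M. \<exists>k\<ge>K. p \<in> return_set B C (n k) \<and> fst p \<notin> Z (n k) \<and> snd p \<notin> Z (n k)"
proof -
  let ?m = "measure (M \<Otimes>\<^sub>M M)"
  let ?r = "prob B * prob C"
  define Z2 where "Z2 i = Z i \<times> space M \<union> space M \<times> Z i" for i
  have Z2 [measurable]: "Z2 i \<in> sets (M \<Otimes>\<^sub>M M)" for i
    using Z(1)[of i] by (auto simp: Z2_def)
  have R [measurable]: "return_set B C i \<in> sets (M \<Otimes>\<^sub>M M)" for i
    using B C by simp
  define N where "N = space (M \<Otimes>\<^sub>M M) - (\<Union>k\<in>{K..}. return_set B C (n k) - Z2 (n k))"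
  have N [measurable]: "N \<in> sets (M \<Otimes>\<^sub>M M)"
    unfolding N_def by measurable
  have "?m N = 0"
  proof (rule ccontr)
    assume "?m N \<noteq> 0"
    then have "?m N > 0"
      by (simp add: zero_less_measure_iff)
    \<comment> \<open>With a third, the return set meets \<open>N\<close> in measure above
      \<open>2 * e\<close>, whereas \<open>Z2 (n k)\<close> has measure below
      \<open>2 * e\<close>.\<close>
    define e where "e = ?r * ?m N / 3"
    have "e > 0"
      using \<open>?m N > 0\<close> B C by (simp add: e_def)
    obtain K' where K': "\<And>i. i \<ge> K' \<Longrightarrow> norm (prob (Z i) - 0) < e"
      using LIMSEQ_D[OF Z(2) \<open>e > 0\<close>] by blast
    obtain k where k: "k \<ge> max K K'" "\<bar>?m (return_set B C (n k) \<inter> N) - ?r * ?m N\<bar> < e"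
      using cesaro_null_syndetic[OF _ square_mixing[OF B(1) C(1) N] n \<open>e > 0\<close>, of "max K K'"] by auto
    have "n k \<ge> K'"
      using k(1) seq_suble[OF n(1), of k] by simp
    then have "prob (Z (n k)) < e"
      using K' by auto
    have "return_set B C (n k) \<inter> N \<subseteq> Z2 (n k)"
      using k(1) by (auto simp: N_def)
    then have "?m (return_set B C (n k) \<inter> N) \<le> ?m (Z2 (n k))"
      by (intro square.finite_measure_mono) auto
    also have "\<dots> \<le> ?m (Z (n k) \<times> space M) + ?m (space M \<times> Z (n k))"
      unfolding Z2_def using Z(1) by (intro measure_Un_le) auto
    also have "\<dots> = 2 * prob (Z (n k))"
      using Z(1) by (simp add: measure_square_Times prob_space)
    finally show False
      using k(2) \<open>prob (Z (n k)) < e\<close> unfolding e_def by linarith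
  qed
  then have "N \<in> null_sets (M \<Otimes>\<^sub>M M)"
    by (auto simp: square.emeasure_eq_measure)
  then have "AE p in M \<Otimes>\<^sub>M M. p \<notin> N"
    by (rule AE_not_in)
  with AE_space show ?thesis
    by eventually_elim (auto simp: N_def Z2_def space_pair_measure)
qed

end

section \<open>Countable bases and transitive points\<close>

lemma closure_UNIV_meets_open:
  assumes "closure D = UNIV" "open U" "U \<noteq> {}"
  shows "\<exists>x\<in>D. x \<in> U"
  using assms by (metis Int_UNIV_right disjoint_iff open_Int_closure_eq_empty)

text \<open>Balls of radius 1/(k+1) about the points of \<open>C\<close> form a basis. This serves
  the Banach space directly and the compact base through finite nets.\<close>

lemma countable_dense_imp_countable_basis:
  fixes C :: "'a::metric_space set"
  assumes "countable C" "closure C = UNIV"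
  shows "\<exists>\<B>. countable \<B> \<and> topological_basis (\<B> :: 'a set set)"
proof (intro exI conjI)
  let ?B = "(\<lambda>(c, k). ball c (1 / real (Suc k))) ` (C \<times> (UNIV :: nat set))"
  show "countable ?B"
    using assms(1) by auto
  show "topological_basis ?B"
  proof (rule topological_basisI)
    fix U :: "'a set" and x assume "open U" "x \<in> U"
    then obtain e where e: "e > 0" "ball x e \<subseteq> U"
      by (meson openE)
    obtain k where k: "1 / real (Suc k) < e / 2"
      using reals_Archimedean[of "e / 2"] e(1) by (auto simp: inverse_eq_divide)
    obtain c where c: "c \<in> C" "dist c x < 1 / real (Suc k)"
      using assms(2) closure_approachable[of x C] by (metis UNIV_I of_nat_0_less_iff zero_less_Suc zero_less_divide_1_iff)
    have "ball c (1 / real (Suc k)) \<subseteq> ball x e"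
    proof
      fix z assume "z \<in> ball c (1 / real (Suc k))"
      then show "z \<in> ball x e"
        using dist_triangle3[of x z c] c(2) k by auto
    qed
    with c e(2) show "\<exists>B'\<in>?B. x \<in> B' \<and> B' \<subseteq> U"
      by (intro bexI[of _ "ball c (1 / real (Suc k))"]) auto
  qed auto
qed

text \<open>Total boundedness gives a finite net for each radius 1/(j+1); the union of these nets is
  countable and dense.\<close>

lemma compact_UNIV_imp_countable_basis:
  assumes "compact (UNIV :: 'a::metric_space set)"
  shows "\<exists>\<B>. countable \<B> \<and> topological_basis (\<B> :: 'a set set)"
proof -
  have "\<exists>k. finite k \<and> (UNIV :: 'a set) \<subseteq> (\<Union>x\<in>k. ball x (1 / real (Suc j)))" for j
    using assms unfolding compact_eq_totally_bounded by simp
  then obtain k where k: "\<And>j. finite (k j)" "\<And>j. (UNIV :: 'a set) \<subseteq> (\<Union>x\<in>k j. ball x (1 / real (Suc j)))"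
    by metis
  have "closure (\<Union>j. k j) = UNIV"
  proof (intro UNIV_eq_I[symmetric] allI)
    fix y :: 'a
    show "y \<in> closure (\<Union>j. k j)"
      unfolding closure_approachable
    proof (intro allI impI)
      fix e :: real assume "e > 0"
      then obtain j where "1 / real (Suc j) < e"
        using reals_Archimedean[of e] by (auto simp: inverse_eq_divide)
      moreover obtain x where "x \<in> k j" "dist x y < 1 / real (Suc j)"
        using subsetD[OF k(2)[of j] UNIV_I[of y]] by auto
      ultimately show "\<exists>x\<in>\<Union>j. k j. dist x y < e"
        by (intro bexI[of _ x]) auto
    qed
  qed
  moreover have "countable (\<Union>j. k j)"
    using k(1) by (intro countable_UN) (auto intro: countable_finite)
  ultimately show ?thesis
    by (intro countable_dense_imp_countable_basis)
qed

text \<open>The orbit enters \<open>U\<close> at some time \<open>m\<close>. Deleting its first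
  \<open>m + 1\<close> points from \<open>V\<close> leaves a nonempty open set, as there are no
  isolated points, so the orbit enters \<open>V\<close> at a time after \<open>m\<close>.\<close>

lemma transitive_point_imp_topologically_transitive:
  fixes S :: "'y::t1_space \<Rightarrow> 'y"
  assumes cont: "continuous_on UNIV S"
    and perfect: "\<And>y::'y. \<not> open {y}"
    and y: "y \<in> transitive_points S"
  shows "topologically_transitive S"
  unfolding topologically_transitive_def
proof (intro conjI cont allI impI)
  fix U V :: "'y set"
  assume UV: "open U \<and> U \<noteq> {} \<and> open V \<and> V \<noteq> {}"
  have hit: "\<exists>n. (S ^^ n) y \<in> W" if "open W" "W \<noteq> {}" for W
    using closure_UNIV_meets_open[OF _ that, of "{(S ^^ n) y |n. True}"] y
    by (auto simp: transitive_points_def)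
  obtain m where m: "(S ^^ m) y \<in> U"
    using hit UV by blast
  define F where "F = (\<lambda>i. (S ^^ i) y) ` {..m}"
  have "V - F \<noteq> {}"
  proof
    \<comment> \<open>If the finite set \<open>F\<close> covered \<open>V\<close>, removing all its
      points except one \<open>v\<close> of \<open>V\<close> would make \<open>{v}\<close>
      open.\<close>
    assume "V - F = {}"
    moreover obtain v where "v \<in> V"
      using UV by blast
    ultimately have "V - (F - {v}) = {v}"
      by auto
    moreover have "open (V - (F - {v}))"
      using UV by (intro open_Diff finite_imp_closed) (auto simp: F_def)
    ultimately show False
      using perfect by metis
  qed
  moreover have "open (V - F)"
    using UV by (intro open_Diff finite_imp_closed) (auto simp: F_def)
  ultimately obtain l where l: "(S ^^ l) y \<in> V - F"
    using hit by blast
  then have "l > m"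
    by (auto simp: F_def not_le intro: ccontr)
  then have "(S ^^ (l - m)) ((S ^^ m) y) \<in> V"
    using l by (metis DiffD1 comp_apply funpow_add le_add_diff_inverse2 less_imp_le)
  with m \<open>l > m\<close> show "\<exists>n\<ge>1. (S ^^ n) ` U \<inter> V \<noteq> {}"
    by (intro exI[of _ "l - m"]) auto
qed

section \<open>Skew products\<close>

text \<open>Provides joint continuity of complex scaling, hence continuity of the skew
  product.\<close>

lemma bounded_bilinear_scaleC: "bounded_bilinear (scaleC :: complex \<Rightarrow> 'x \<Rightarrow> 'x::complex_banach)"
proof
  fix r :: real and c :: complex and x :: 'x
  show "(r *\<^sub>R c) *\<^sub>C x = r *\<^sub>R (c *\<^sub>C x)"
    by (simp add: scaleR_conv_of_real flip: scaleC_of_real scaleC_scaleC)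
  show "c *\<^sub>C r *\<^sub>R x = r *\<^sub>R (c *\<^sub>C x)"
    by (simp add: scaleC_scaleC mult.commute flip: scaleC_of_real)
  show "\<exists>K. \<forall>c (x :: 'x). norm (c *\<^sub>C x) \<le> norm c * norm x * K"
    by (intro exI[of _ 1]) (simp add: norm_scaleC)
qed (simp_all add: scaleC_add_left scaleC_add_right)

lemma bounded_clinear_funpow:
  fixes T :: "'x::complex_banach \<Rightarrow> 'x"
  shows "bounded_clinear T \<Longrightarrow> bounded_clinear (T ^^ n)"
proof (induction n)
  case 0
  show ?case
    by (simp add: bounded_clinear_def id_def bounded_linear_ident)
next
  case (Suc n)
  then have "bounded_linear (\<lambda>x. T ((T ^^ n) x))"
    by (auto simp: bounded_clinear_def intro: bounded_linear_compose[of T "T ^^ n"])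
  with Suc show ?case
    by (simp add: bounded_clinear_def o_def)
qed

definition cocycle :: "('a \<Rightarrow> 'a) \<Rightarrow> ('a \<Rightarrow> complex) \<Rightarrow> nat \<Rightarrow> 'a \<Rightarrow> complex"
  where "cocycle f h n a = (\<Prod>i<n. h ((f ^^ i) a))"

lemma skew_product_funpow:
  assumes "bounded_clinear T"
  shows "(skew_product f h T ^^ n) (a, x) = ((f ^^ n) a, cocycle f h n a *\<^sub>C (T ^^ n) x)"
proof (induction n)
  case (Suc n)
  then show ?case
    using assms by (simp add: skew_product_def cocycle_def bounded_clinear_def scaleC_scaleC mult.commute)
qed (simp add: cocycle_def scaleC_one)

lemma continuous_on_skew_product:
  assumes "continuous_on UNIV f" "continuous_on UNIV h" "bounded_clinear T"
  shows "continuous_on UNIV (skew_product f h T)"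
proof -
  have "bounded_linear T"
    using assms(3) by (simp add: bounded_clinear_def)
  then have "continuous_on UNIV (\<lambda>p. T (snd p))"
    by (intro bounded_linear.continuous_on[of T] continuous_intros)
  moreover have "continuous_on UNIV (\<lambda>p. f (fst p))" "continuous_on UNIV (\<lambda>p. h (fst p))"
    by (intro continuous_on_compose2[OF assms(1)] continuous_on_compose2[OF assms(2)] continuous_intros; simp)+
  ultimately show ?thesis
    unfolding skew_product_def case_prod_beta
    by (intro continuous_on_Pair bounded_bilinear.continuous_on[OF bounded_bilinear_scaleC])
qed

text \<open>With a real \<open>c\<close> strictly between the limsup and \<open>exp s\<close>, the
  rate \<open>\<sigma> = ln c\<close> works: the root condition becomes an exponential
  bound.\<close>

lemma limsup_root_less_exp:
  assumes lim: "limsup (\<lambda>k. ereal (u k powr (1 / real (n k)))) < ereal (exp s)"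
    and "\<And>k. u k \<ge> 0" "\<And>k. n k > 0"
  shows "\<exists>\<sigma><s. \<forall>\<^sub>F k in sequentially. u k \<le> exp (real (n k) * \<sigma>)"
proof -
  obtain c where c: "limsup (\<lambda>k. ereal (u k powr (1 / real (n k)))) < ereal c" "ereal c < ereal (exp s)"
    using ereal_dense2[OF lim] by auto
  have ev: "\<forall>\<^sub>F k in sequentially. u k powr (1 / real (n k)) < c"
    using Limsup_lessD[OF c(1)] by simp
  then obtain k where "u k powr (1 / real (n k)) < c"
    by (auto simp: eventually_sequentially)
  then have "c > 0"
    by (meson le_less_trans powr_ge_zero)
  show ?thesis
  proof (intro exI[of _ "ln c"] conjI)
    show "ln c < s"
      using c(2) \<open>c > 0\<close> by (metis less_ereal.simps(1) ln_exp ln_less_cancel_iff exp_gt_zero)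
    show "\<forall>\<^sub>F k in sequentially. u k \<le> exp (real (n k) * ln c)"
      using ev
    proof (rule eventually_mono)
      fix k assume less: "u k powr (1 / real (n k)) < c"
      show "u k \<le> exp (real (n k) * ln c)"
      \<comment> \<open>The logarithm is usable only for positive \<open>u k\<close>; for
        \<open>u k = 0\<close> the bound is trivial.\<close>
      proof (cases "u k = 0")
        case False
        then have "u k > 0"
          using assms(2)[of k] by simp
        have "ln (u k powr (1 / real (n k))) < ln c"
          using less \<open>u k > 0\<close> \<open>c > 0\<close> by (subst ln_less_cancel_iff) auto
        then have "ln (u k) < real (n k) * ln c"
          using assms(3)[of k] \<open>u k > 0\<close> by (simp add: ln_powr field_simps)
        then show ?thesis
          using \<open>u k > 0\<close> by (metis exp_le_cancel_iff exp_ln less_imp_le)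
      qed simp
    qed
  qed
qed

text \<open>The vector \<open>u\<close> is \<open>x + inverse z *\<^sub>C S (n k) y\<close>. If
  \<open>ln (cmod z)\<close> is close to \<open>real (n k) * \<gamma>\<close>, both the correction
  to \<open>x\<close> and the image of \<open>x\<close> decay exponentially. The scalar
  \<open>z\<close> stands for a cocycle value; quantifying over it after \<open>k\<close> makes the
  estimate uniform in the base point.\<close>

lemma fiber_approximation:
  fixes T :: "'x::complex_banach \<Rightarrow> 'x" and n :: "nat \<Rightarrow> nat"
  assumes T: "bounded_clinear T"
    and n: "strict_mono n" "\<And>k. n k > 0"
    and x: "limsup (\<lambda>k. ereal (norm ((T ^^ n k) x) powr (1 / real (n k)))) < ereal (exp (- \<gamma>))"
    and y: "limsup (\<lambda>k. ereal (norm (S (n k) y) powr (1 / real (n k)))) < ereal (exp \<gamma>)"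
    and TS: "(\<lambda>k. norm ((T ^^ n k) (S (n k) y) - y)) \<longlonglongrightarrow> 0"
  shows "\<exists>\<rho>>0. \<forall>\<delta>>0. \<forall>\<^sub>F k in sequentially.
    \<forall>z. z \<noteq> 0 \<and> \<bar>ln (cmod z) - real (n k) * \<gamma>\<bar> < \<rho> * real (n k) \<longrightarrow>
      (\<exists>u. dist u x < \<delta> \<and> dist (z *\<^sub>C (T ^^ n k) u) y < \<delta>)"
proof -
  obtain \<sigma> where \<sigma>: "\<sigma> < - \<gamma>" "\<forall>\<^sub>F k in sequentially. norm ((T ^^ n k) x) \<le> exp (real (n k) * \<sigma>)"
    using limsup_root_less_exp[OF x] n(2) by auto
  obtain \<tau> where \<tau>: "\<tau> < \<gamma>" "\<forall>\<^sub>F k in sequentially. norm (S (n k) y) \<le> exp (real (n k) * \<tau>)"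
    using limsup_root_less_exp[OF y] n(2) by auto
  \<comment> \<open>Half of the smaller gap: one \<open>\<rho>\<close> absorbs the deviation of the
    growth rate of \<open>z\<close>, the other remains as rate of decay.\<close>
  define \<rho> where "\<rho> = min (- \<gamma> - \<sigma>) (\<gamma> - \<tau>) / 2"
  have \<rho>: "\<rho> > 0" "\<gamma> + \<rho> + \<sigma> \<le> - \<rho>" "- (\<gamma> - \<rho>) + \<tau> \<le> - \<rho>"
    using \<sigma>(1) \<tau>(1) by (auto simp: \<rho>_def min_def)
  have "(\<lambda>m. exp (- \<rho>) ^ m) \<longlonglongrightarrow> 0"
    using \<rho>(1) by (intro LIMSEQ_realpow_zero) auto
  then have "(\<lambda>k. exp (- \<rho>) ^ n k) \<longlonglongrightarrow> 0"
    using LIMSEQ_subseq_LIMSEQ[OF _ n(1)] by (auto simp: o_def)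
  then have exp_0: "(\<lambda>k. exp (real (n k) * - \<rho>)) \<longlonglongrightarrow> 0"
    unfolding exp_of_nat_mult .
  show ?thesis
  proof (intro exI[of _ \<rho>] conjI \<rho>(1) allI impI)
    fix \<delta> :: real assume "\<delta> > 0"
    have "\<forall>\<^sub>F k in sequentially. exp (real (n k) * - \<rho>) < \<delta> / 2"
      using order_tendstoD(2)[OF exp_0, of "\<delta> / 2"] \<open>\<delta> > 0\<close> by simp
    moreover have "\<forall>\<^sub>F k in sequentially. norm ((T ^^ n k) (S (n k) y) - y) < \<delta> / 2"
      using order_tendstoD(2)[OF TS, of "\<delta> / 2"] \<open>\<delta> > 0\<close> by simp
    ultimately show "\<forall>\<^sub>F k in sequentially.
        \<forall>z. z \<noteq> 0 \<and> \<bar>ln (cmod z) - real (n k) * \<gamma>\<bar> < \<rho> * real (n k) \<longrightarrow>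
          (\<exists>u. dist u x < \<delta> \<and> dist (z *\<^sub>C (T ^^ n k) u) y < \<delta>)"
      using \<sigma>(2) \<tau>(2)
    proof eventually_elim
      case (elim k)
      show ?case
      proof (intro allI impI)
        fix z assume z: "z \<noteq> 0 \<and> \<bar>ln (cmod z) - real (n k) * \<gamma>\<bar> < \<rho> * real (n k)"
        let ?L = "ln (cmod z)"
        have cmod_z: "cmod z = exp ?L" "cmod (inverse z) = exp (- ?L)"
          using z by (simp_all add: norm_inverse exp_minus)
        have L: "?L \<le> real (n k) * (\<gamma> + \<rho>)" "- ?L \<le> real (n k) * (- (\<gamma> - \<rho>))"
          using z by (auto simp: abs_if algebra_simps split: if_splits)
        have small_T: "norm (z *\<^sub>C (T ^^ n k) x) < \<delta> / 2"
        proof -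
          have "norm (z *\<^sub>C (T ^^ n k) x) \<le> exp ?L * exp (real (n k) * \<sigma>)"
            unfolding norm_scaleC using elim(3) cmod_z(1) by (intro mult_mono) auto
          also have "\<dots> \<le> exp (real (n k) * (\<gamma> + \<rho> + \<sigma>))"
            using L(1) by (simp add: algebra_simps flip: exp_add)
          also have "\<dots> \<le> exp (real (n k) * - \<rho>)"
            using mult_left_mono[OF \<rho>(2), of "real (n k)"] by simp
          finally show ?thesis using elim(1) by simp
        qed
        have small_S: "norm (inverse z *\<^sub>C S (n k) y) < \<delta> / 2"
        proof -
          have "norm (inverse z *\<^sub>C S (n k) y) \<le> exp (- ?L) * exp (real (n k) * \<tau>)"
            unfolding norm_scaleC cmod_z(2) using elim(4) by (intro mult_mono) auto
          also have "\<dots> \<le> exp (real (n k) * (- (\<gamma> - \<rho>) + \<tau>))"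
            using L(2) by (simp add: algebra_simps flip: exp_add)
          also have "\<dots> \<le> exp (real (n k) * - \<rho>)"
            using mult_left_mono[OF \<rho>(3), of "real (n k)"] by simp
          finally show ?thesis using elim(1) by simp
        qed
        let ?u = "x + inverse z *\<^sub>C S (n k) y"
        have "bounded_clinear (T ^^ n k)"
          using T by (rule bounded_clinear_funpow)
        then have "(T ^^ n k) ?u = (T ^^ n k) x + inverse z *\<^sub>C (T ^^ n k) (S (n k) y)"
          by (simp add: bounded_clinear_def linear_simps)
        then have "z *\<^sub>C (T ^^ n k) ?u = z *\<^sub>C (T ^^ n k) x + (T ^^ n k) (S (n k) y)"
          using z by (simp add: scaleC_add_right scaleC_scaleC scaleC_one)
        then have "dist (z *\<^sub>C (T ^^ n k) ?u) y
            \<le> norm (z *\<^sub>C (T ^^ n k) x) + norm ((T ^^ n k) (S (n k) y) - y)"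
          unfolding dist_norm by (simp add: norm_triangle_ineq flip: add_diff_eq)
        then have "dist (z *\<^sub>C (T ^^ n k) ?u) y < \<delta>"
          using small_T elim(2) by simp
        moreover have "dist ?u x < \<delta>"
          using small_S \<open>\<delta> > 0\<close> by (simp add: dist_norm)
        ultimately show "\<exists>u. dist u x < \<delta> \<and> dist (z *\<^sub>C (T ^^ n k) u) y < \<delta>"
          by blast
      qed
    qed
  qed
qed

text \<open>Nonvanishing is demanded separately because \<open>ln 0 = 0\<close> could let a zero
  cocycle satisfy the bound, and the cocycle has to be inverted in the fibre.\<close>

definition growth_within :: "('a \<Rightarrow> 'a) \<Rightarrow> ('a \<Rightarrow> complex) \<Rightarrow> real \<Rightarrow> real \<Rightarrow> nat \<Rightarrow> 'a \<Rightarrow> bool"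
  where "growth_within f h \<gamma> \<epsilon> m a \<longleftrightarrow>
    cocycle f h m a \<noteq> 0 \<and> \<bar>ln (cmod (cocycle f h m a)) - real m * \<gamma>\<bar> < \<epsilon> * real m"

lemma growth_within_mono:
  "growth_within f h \<gamma> \<epsilon> m a \<Longrightarrow> \<epsilon> \<le> \<epsilon>' \<Longrightarrow> growth_within f h \<gamma> \<epsilon>' m a"
  unfolding growth_within_def by (meson less_le_trans mult_right_mono of_nat_0_le_iff)

section \<open>Transitive points over a pair of base points, by Baire category\<close>

lemma map_prod_funpow:
  fixes S :: "'p \<Rightarrow> 'p" and R :: "'q \<Rightarrow> 'q"
  shows "(map_prod S R ^^ m) (p, q) = ((S ^^ m) p, (R ^^ m) q)"
  by (induction m) auto

text \<open>\<open>G U V W W'\<close> collects the fibre vectors over \<open>(a, b)\<close> whose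
  joint orbit visits a given box. It is open, and dense by \<open>fiber_approximation\<close> at the
  return times; any point in the intersection over all basic boxes is transitive. The assumption
  \<open>returns\<close> speaks of basic sets so that it can be met almost surely.\<close>

lemma transitive_point_over_returning_pair:
  fixes f :: "'a::metric_space \<Rightarrow> 'a"
    and T :: "'x::complex_banach \<Rightarrow> 'x"
    and n :: "nat \<Rightarrow> nat"
  assumes \<A>: "countable \<A>" "topological_basis (\<A> :: 'a set set)"
    and \<X>: "countable \<X>" "topological_basis (\<X> :: 'x set set)"
    and T: "bounded_clinear T"
    and n: "strict_mono n" "\<And>k. n k > 0"
    and D: "closure D\<^sub>1 = UNIV" "closure D\<^sub>2 = UNIV"
    and D\<^sub>1: "\<And>x. x \<in> D\<^sub>1 \<Longrightarrow> limsup (\<lambda>k. ereal (norm ((T ^^ n k) x) powr (1 / real (n k)))) < ereal (exp (- \<gamma>))"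
    and D\<^sub>2: "\<And>y. y \<in> D\<^sub>2 \<Longrightarrow> limsup (\<lambda>k. ereal (norm (S (n k) y) powr (1 / real (n k)))) < ereal (exp \<gamma>)"
    and TS: "\<And>y. y \<in> D\<^sub>2 \<Longrightarrow> (\<lambda>k. norm ((T ^^ n k) (S (n k) y) - y)) \<longlonglongrightarrow> 0"
    and returns: "\<And>U V \<epsilon> K. U \<in> \<A> \<Longrightarrow> V \<in> \<A> \<Longrightarrow> U \<noteq> {} \<Longrightarrow> V \<noteq> {} \<Longrightarrow> \<epsilon> > 0 \<Longrightarrow>
      \<exists>k\<ge>K. (f ^^ n k) a \<in> U \<and> (f ^^ n k) b \<in> V \<and>
        growth_within f h \<gamma> \<epsilon> (n k) a \<and> growth_within f h \<gamma> \<epsilon> (n k) b"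
  shows "\<exists>x y. ((a, x), (b, y)) \<in> transitive_points (map_prod (skew_product f h T) (skew_product f h T))"
proof -
  let ?c = "cocycle f h"
  define G where "G U V W W' = {(x, y). \<exists>m. (f ^^ m) a \<in> U \<and> (f ^^ m) b \<in> V \<and>
      ?c m a *\<^sub>C (T ^^ m) x \<in> W \<and> ?c m b *\<^sub>C (T ^^ m) y \<in> W'}" for U V W W'
  have open_G: "open (G U V W W')" if "open W" "open W'" for U V W W'
  proof -
    have "bounded_linear (\<lambda>x. z *\<^sub>C (T ^^ m) x)" for z m
      using bounded_clinear_funpow[OF T, of m]
        bounded_linear_compose[OF bounded_bilinear.bounded_linear_right[OF bounded_bilinear_scaleC]]
      by (auto simp: bounded_clinear_def)
    then have cont: "continuous_on UNIV (\<lambda>p. (?c m a *\<^sub>C (T ^^ m) (fst p), ?c m b *\<^sub>C (T ^^ m) (snd p)))" for m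
      by (intro continuous_on_Pair bounded_linear.continuous_on[where f = "\<lambda>x. _ *\<^sub>C (T ^^ m) x"] continuous_intros)
    have "G U V W W' = (\<Union>m\<in>{m. (f ^^ m) a \<in> U \<and> (f ^^ m) b \<in> V}.
        (\<lambda>p. (?c m a *\<^sub>C (T ^^ m) (fst p), ?c m b *\<^sub>C (T ^^ m) (snd p))) -` (W \<times> W'))"
      by (auto simp: G_def)
    then show ?thesis
      using that by (auto intro!: open_UN open_vimage[OF _ cont] open_Times)
  qed
  have dense_G: "closure (G U V W W') = UNIV"
    if UV: "U \<in> \<A>" "V \<in> \<A>" "U \<noteq> {}" "V \<noteq> {}" and W: "open W" "open W'" "W \<noteq> {}" "W' \<noteq> {}" for U V W W'
  proof (rule ccontr)
    assume "closure (G U V W W') \<noteq> UNIV"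
    then obtain p where "p \<in> - closure (G U V W W')"
      by auto
    then obtain B B' where B: "open B" "open B'" "p \<in> B \<times> B'" "B \<times> B' \<subseteq> - closure (G U V W W')"
      using open_prod_elim[of "- closure (G U V W W')"] by (metis closed_closure open_Compl)
    \<comment> \<open>Starting vectors are taken from \<open>D\<^sub>1\<close> inside the missed box
      \<open>B \<times> B'\<close>, target vectors from \<open>D\<^sub>2\<close> inside
      \<open>W\<close> and \<open>W'\<close>.\<close>
    obtain x x' where x: "x \<in> D\<^sub>1" "x \<in> B" "x' \<in> D\<^sub>1" "x' \<in> B'"
      using closure_UNIV_meets_open[OF D(1)] B by (metis empty_iff mem_Times_iff)
    obtain y y' where y: "y \<in> D\<^sub>2" "y \<in> W" "y' \<in> D\<^sub>2" "y' \<in> W'"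
      using closure_UNIV_meets_open[OF D(2)] W by metis
    \<comment> \<open>The base point \<open>c\<close> is quantified after \<open>k\<close>, so the
      threshold depends neither on it nor on the return time chosen later.\<close>
    have approx: "\<exists>\<rho>>0. \<forall>\<delta>>0. \<forall>\<^sub>F k in sequentially.
        \<forall>c. growth_within f h \<gamma> \<rho> (n k) c \<longrightarrow>
          (\<exists>u. dist u x < \<delta> \<and> dist (?c (n k) c *\<^sub>C (T ^^ n k) u) y < \<delta>)"
      if xy: "x \<in> D\<^sub>1" "y \<in> D\<^sub>2" for x y
    proof -
      obtain \<rho> where \<rho>: "\<rho> > 0" and ev: "\<And>\<delta>. \<delta> > 0 \<Longrightarrow> \<forall>\<^sub>F k in sequentially.
          \<forall>z. z \<noteq> 0 \<and> \<bar>ln (cmod z) - real (n k) * \<gamma>\<bar> < \<rho> * real (n k) \<longrightarrow>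
            (\<exists>u. dist u x < \<delta> \<and> dist (z *\<^sub>C (T ^^ n k) u) y < \<delta>)"
        using fiber_approximation[where S = S, OF T n D\<^sub>1[OF xy(1)] D\<^sub>2[OF xy(2)] TS[OF xy(2)]] by blast
      show ?thesis
      proof (intro exI[of _ \<rho>] conjI \<rho> allI impI)
        fix \<delta> :: real assume "\<delta> > 0"
        from ev[OF this] show "\<forall>\<^sub>F k in sequentially. \<forall>c. growth_within f h \<gamma> \<rho> (n k) c \<longrightarrow>
            (\<exists>u. dist u x < \<delta> \<and> dist (?c (n k) c *\<^sub>C (T ^^ n k) u) y < \<delta>)"
          by (rule eventually_mono) (auto simp: growth_within_def)
      qed
    qed
    obtain \<delta> where \<delta>: "\<delta> > 0" "ball x \<delta> \<subseteq> B" "ball x' \<delta> \<subseteq> B'" "ball y \<delta> \<subseteq> W" "ball y' \<delta> \<subseteq> W'"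
    proof -
      obtain d1 d2 d3 d4 where "d1 > 0" "ball x d1 \<subseteq> B" "d2 > 0" "ball x' d2 \<subseteq> B'"
          "d3 > 0" "ball y d3 \<subseteq> W" "d4 > 0" "ball y' d4 \<subseteq> W'"
        using B W x y by (metis openE)
      then show ?thesis
        by (intro that[of "min (min d1 d2) (min d3 d4)"]) (auto simp: subset_iff)
    qed
    obtain \<rho> where \<rho>: "\<rho> > 0" "\<forall>\<^sub>F k in sequentially. \<forall>c. growth_within f h \<gamma> \<rho> (n k) c \<longrightarrow>
          (\<exists>u. dist u x < \<delta> \<and> dist (?c (n k) c *\<^sub>C (T ^^ n k) u) y < \<delta>)"
      using approx[OF x(1) y(1)] \<delta>(1) by blast
    obtain \<rho>' where \<rho>': "\<rho>' > 0" "\<forall>\<^sub>F k in sequentially. \<forall>c. growth_within f h \<gamma> \<rho>' (n k) c \<longrightarrow>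
          (\<exists>u. dist u x' < \<delta> \<and> dist (?c (n k) c *\<^sub>C (T ^^ n k) u) y' < \<delta>)"
      using approx[OF x(3) y(3)] \<delta>(1) by blast
    obtain K where K: "\<forall>k\<ge>K.
        (\<forall>c. growth_within f h \<gamma> \<rho> (n k) c \<longrightarrow>
          (\<exists>u. dist u x < \<delta> \<and> dist (?c (n k) c *\<^sub>C (T ^^ n k) u) y < \<delta>)) \<and>
        (\<forall>c. growth_within f h \<gamma> \<rho>' (n k) c \<longrightarrow>
          (\<exists>u. dist u x' < \<delta> \<and> dist (?c (n k) c *\<^sub>C (T ^^ n k) u) y' < \<delta>))"
      using eventually_conj[OF \<rho>(2) \<rho>'(2)] unfolding eventually_sequentially by blast
    \<comment> \<open>One return time must serve both coordinates, hence the minimum of the two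
      tolerances and the common threshold \<open>K\<close>.\<close>
    obtain k where k: "k \<ge> K" "(f ^^ n k) a \<in> U" "(f ^^ n k) b \<in> V"
        "growth_within f h \<gamma> (min \<rho> \<rho>') (n k) a" "growth_within f h \<gamma> (min \<rho> \<rho>') (n k) b"
      using returns[OF UV, of "min \<rho> \<rho>'" K] \<rho>(1) \<rho>'(1) by auto
    obtain u where u: "dist u x < \<delta>" "dist (?c (n k) a *\<^sub>C (T ^^ n k) u) y < \<delta>"
      using K k(1) growth_within_mono[OF k(4) min.cobounded1] by blast
    obtain v where v: "dist v x' < \<delta>" "dist (?c (n k) b *\<^sub>C (T ^^ n k) v) y' < \<delta>"
      using K k(1) growth_within_mono[OF k(5) min.cobounded2] by blast
    have "(u, v) \<in> B \<times> B'"
      using u(1) v(1) \<delta>(2,3) by (auto simp: dist_commute subset_iff)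
    moreover have "(u, v) \<in> G U V W W'"
      unfolding G_def using k(2,3) u(2) v(2) \<delta>(4,5) by (auto simp: dist_commute subset_iff)
    ultimately show False
      using B(4) closure_subset by blast
  qed
  \<comment> \<open>Empty basic sets are removed, since \<open>G\<close> is empty and not dense for
    an empty target.\<close>
  define \<G> where "\<G> = (\<lambda>(U, V, W, W'). G U V W W') `
      ((\<A> - {{}}) \<times> (\<A> - {{}}) \<times> (\<X> - {{}}) \<times> (\<X> - {{}}))"
  have "euclidean closure_of \<Inter>\<G> = topspace (euclidean :: ('x \<times> 'x) topology)"
  proof (rule Baire_category)
    show "countable \<G>"
      unfolding \<G>_def using \<A>(1) \<X>(1) by auto
    show "openin euclidean A \<and> euclidean closure_of A = topspace euclidean" if A: "A \<in> \<G>" for A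
    proof -
      obtain U V W W' where "A = G U V W W'" "U \<in> \<A>" "V \<in> \<A>" "U \<noteq> {}" "V \<noteq> {}"
          "W \<in> \<X>" "W' \<in> \<X>" "W \<noteq> {}" "W' \<noteq> {}"
        using A by (auto simp: \<G>_def)
      then show ?thesis
        using topological_basis_open[OF \<X>(2)] by (simp add: open_G dense_G)
    qed
  qed (simp add: completely_metrizable_space_euclidean)
  then have "\<Inter>\<G> \<noteq> {}"
    by auto
  then obtain x y where xy: "(x, y) \<in> \<Inter>\<G>"
    by auto
  let ?P = "skew_product f h T"
  have "closure {(map_prod ?P ?P ^^ m) ((a, x), (b, y)) |m. True} = UNIV" (is "closure ?orbit = UNIV")
  proof (rule ccontr)
    assume "closure ?orbit \<noteq> UNIV"
    then obtain p where p: "p \<in> - closure ?orbit"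
      by auto
    have "topological_basis ((\<lambda>(a, b). a \<times> b) ` (((\<lambda>(a, b). a \<times> b) ` (\<A> \<times> \<X>)) \<times> ((\<lambda>(a, b). a \<times> b) ` (\<A> \<times> \<X>))))"
      by (intro topological_basis_prod \<A> \<X>)
    then obtain Q where Q: "Q \<in> (\<lambda>(a, b). a \<times> b) ` (((\<lambda>(a, b). a \<times> b) ` (\<A> \<times> \<X>)) \<times> ((\<lambda>(a, b). a \<times> b) ` (\<A> \<times> \<X>)))"
        "p \<in> Q" "Q \<subseteq> - closure ?orbit"
      using topological_basisE[OF _ open_Compl[OF closed_closure] p] by blast
    then obtain U V W W' where UVW: "U \<in> \<A>" "V \<in> \<A>" "W \<in> \<X>" "W' \<in> \<X>" "Q = (U \<times> W) \<times> (V \<times> W')"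
      by auto
    \<comment> \<open>The four factors of \<open>Q\<close> are nonempty because \<open>p\<close>
      lies in \<open>Q\<close>.\<close>
    then have "G U V W W' \<in> \<G>"
      unfolding \<G>_def using Q(2) by (intro image_eqI[of _ _ "(U, V, W, W')"]) auto
    with xy have "(x, y) \<in> G U V W W'"
      by blast
    then obtain m where "(f ^^ m) a \<in> U" "(f ^^ m) b \<in> V"
        "?c m a *\<^sub>C (T ^^ m) x \<in> W" "?c m b *\<^sub>C (T ^^ m) y \<in> W'"
      unfolding G_def by blast
    then have "(map_prod ?P ?P ^^ m) ((a, x), (b, y)) \<in> Q"
      unfolding map_prod_funpow skew_product_funpow[OF T] UVW(5) by blast
    with Q(3) have "(map_prod ?P ?P ^^ m) ((a, x), (b, y)) \<notin> closure ?orbit"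
      by blast
    moreover have "(map_prod ?P ?P ^^ m) ((a, x), (b, y)) \<in> closure ?orbit"
      by (rule subsetD[OF closure_subset]) blast
    ultimately show False
      by (rule notE)
  qed
  then show ?thesis
    unfolding transitive_points_def by blast
qed

section \<open>Returns with controlled growth, and the conclusion\<close>

context weakly_mixing_system
begin

text \<open>The bad set \<open>Z i\<close> is where the cocycle vanishes, a null set because
  \<open>h\<close> is nonzero almost everywhere along iterates, or where its logarithm deviates,
  which has vanishing probability. \<open>AE_simultaneous_return\<close> then avoids
  \<open>Z\<close> in both coordinates.\<close>

lemma AE_growth_return:
  fixes h :: "'a \<Rightarrow> complex"
  assumes h [measurable]: "h \<in> borel_measurable M" and log: "has_log_integral M h \<gamma>"
    and B: "B \<in> sets M" "prob B > 0" and C: "C \<in> sets M" "prob C > 0"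
    and n: "strict_mono n" "syndetic n" and "\<epsilon> > 0"
  shows "AE p in M \<Otimes>\<^sub>M M. \<exists>k\<ge>K. (f ^^ n k) (fst p) \<in> B \<and> (f ^^ n k) (snd p) \<in> C \<and>
    growth_within f h \<gamma> \<epsilon> (n k) (fst p) \<and> growth_within f h \<gamma> \<epsilon> (n k) (snd p)"
proof -
  let ?g = "\<lambda>x. ln (cmod (h x))"
  have g: "integrable M ?g" "expectation ?g = \<gamma>" and h0: "AE x in M. h x \<noteq> 0"
    using log by (auto simp: has_log_integral_def has_bochner_integral_iff)
  define Z0 where "Z0 i = {x\<in>space M. \<bar>(\<Sum>j<i. ?g ((f ^^ j) x)) - real i * \<gamma>\<bar> \<ge> \<epsilon> * real i}" for i
  define Z where "Z i = {x\<in>space M. cocycle f h i x = 0} \<union> Z0 i" for i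
  have cocycle_meas [measurable]: "cocycle f h i \<in> borel_measurable M" for i
    unfolding cocycle_def by measurable
  have Z0_sets [measurable]: "Z0 i \<in> sets M" for i
    unfolding Z0_def by measurable
  have Z_sets [measurable]: "Z i \<in> sets M" for i
    unfolding Z_def by measurable
  have "prob (Z i) = prob (Z0 i)" for i
  proof -
    have "AE x in M. \<forall>j\<in>{..<i}. h ((f ^^ j) x) \<noteq> 0"
      by (intro AE_finite_allI AE_iterate h0) auto
    then have "AE x in M. x \<in> Z i \<longleftrightarrow> x \<in> Z0 i"
      by eventually_elim (simp add: Z_def cocycle_def)
    then show ?thesis
      by (rule finite_measure_eq_AE) measurable
  qed
  moreover have "(\<lambda>i. prob (Z0 i)) \<longlonglongrightarrow> 0"
    using mean_ergodic_in_probability[OF g(1) \<open>\<epsilon> > 0\<close>] unfolding g(2) Z0_def .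
  ultimately have Z_lim: "(\<lambda>i. prob (Z i)) \<longlonglongrightarrow> 0"
    by simp
  have good: "growth_within f h \<gamma> \<epsilon> i x" if "x \<in> space M" "x \<notin> Z i" for i x
  proof -
    have "cocycle f h i x \<noteq> 0"
      using that by (simp add: Z_def)
    moreover from this have "ln (cmod (cocycle f h i x)) = (\<Sum>j<i. ?g ((f ^^ j) x))"
      by (simp add: cocycle_def prod_norm[symmetric]) (subst ln_prod, auto)
    ultimately show ?thesis
      using that by (auto simp: growth_within_def Z_def Z0_def)
  qed
  have "AE p in M \<Otimes>\<^sub>M M. \<exists>k\<ge>K. p \<in> return_set B C (n k) \<and> fst p \<notin> Z (n k) \<and> snd p \<notin> Z (n k)"
    by (intro AE_simultaneous_return B C Z_sets Z_lim n)
  then show ?thesis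
    by eventually_elim (fastforce simp: return_set_def good)
qed

end

theorem theorem4p9:
  fixes f :: "'a::{metric_space, perfect_space} \<Rightarrow> 'a"
    and \<mu> :: "'a measure"
    and h :: "'a \<Rightarrow> complex"
    and \<gamma> :: real
    and T :: "'x::complex_banach \<Rightarrow> 'x"
    and D\<^sub>1 D\<^sub>2 :: "'x set"
    and n :: "nat \<Rightarrow> nat"
    and S :: "nat \<Rightarrow> 'x \<Rightarrow> 'x"
    and P :: "'a \<times> 'x \<Rightarrow> 'a \<times> 'x"
  assumes "compact (UNIV :: 'a set)"
    and "continuous_on UNIV f"
    and "prob_space \<mu>" and "sets \<mu> = sets borel"
    and "full_support \<mu>"
    and "measure_weakly_mixing \<mu> f"
    and "continuous_on UNIV h"
    and "has_log_integral \<mu> h \<gamma>"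
    and "infinite_dimensional TYPE('x)"
    and "separable_space (euclidean :: 'x topology)"
    and "bounded_clinear T"
    and "P = skew_product f h T"
    and "closure D\<^sub>1 = UNIV" and "closure D\<^sub>2 = UNIV"
    and "strict_mono n" and "\<forall>k. n k > 0" and "syndetic n"
    and "\<forall>x\<in>D\<^sub>1. limsup (\<lambda>k. ereal (norm ((T ^^ n k) x) powr (1 / real (n k)))) < ereal (exp (- \<gamma>))"
    and "\<forall>y\<in>D\<^sub>2. limsup (\<lambda>k. ereal (norm (S (n k) y) powr (1 / real (n k)))) < ereal (exp \<gamma>)"
    and "\<forall>y\<in>D\<^sub>2. (\<lambda>k. norm ((T ^^ n k) (S (n k) y) - y)) \<longlonglongrightarrow> 0"
  shows "topologically_weakly_mixing P \<and>
    measure (completion (\<mu> \<Otimes>\<^sub>M \<mu>))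
      {(a, b). \<exists>x y. ((a, x), (b, y)) \<in> transitive_points (map_prod P P)} = 1"
proof -
  interpret prob_space \<mu> by fact
  interpret weakly_mixing_system \<mu> f
    by unfold_locales fact
  have space_\<mu>: "space \<mu> = UNIV"
    using sets_eq_imp_space_eq[OF assms(4)] by simp
  have h_meas: "h \<in> borel_measurable \<mu>"
    using borel_measurable_continuous_onI[OF assms(7)] measurable_cong_sets[OF assms(4) refl] by blast
  obtain \<A> where \<A>: "countable \<A>" "topological_basis (\<A> :: 'a set set)"
    using compact_UNIV_imp_countable_basis[OF assms(1)] by blast
  obtain C where "countable C" "closure C = (UNIV :: 'x set)"
    using assms(10) by (auto simp: separable_space_def)
  then obtain \<X> where \<X>: "countable \<X>" "topological_basis (\<X> :: 'x set set)"
    using countable_dense_imp_countable_basis by blast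
  let ?good = "\<lambda>q k p. growth_within f h \<gamma> (1 / real (Suc q)) (n k) (fst p) \<and>
      growth_within f h \<gamma> (1 / real (Suc q)) (n k) (snd p)"
  \<comment> \<open>Full support enters here: nonempty basic open sets have positive
    measure.\<close>
  have basis: "U \<in> sets \<mu>" "prob U > 0" if "U \<in> \<A> - {{}}" for U
    using that topological_basis_open[OF \<A>(2)] assms(4,5) by (auto simp: full_support_def)
  \<comment> \<open>Basic sets, tolerances 1/(q+1) and thresholds range over countable sets, so the
    exceptional null sets can be united.\<close>
  have "AE p in \<mu> \<Otimes>\<^sub>M \<mu>. \<forall>U\<in>\<A> - {{}}. \<forall>V\<in>\<A> - {{}}. \<forall>q K.
      \<exists>k\<ge>K. (f ^^ n k) (fst p) \<in> U \<and> (f ^^ n k) (snd p) \<in> V \<and> ?good q k p"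
    using AE_growth_return[OF h_meas assms(8) basis basis assms(15,17)] \<A>(1)
    by (simp add: AE_ball_countable AE_all_countable)
  then have AE_trans: "AE p in \<mu> \<Otimes>\<^sub>M \<mu>. \<exists>x y. ((fst p, x), (snd p, y)) \<in> transitive_points (map_prod P P)"
  proof eventually_elim
    case (elim p)
    show ?case
      unfolding assms(12)
    proof (rule transitive_point_over_returning_pair[where S = S, OF \<A> \<X> assms(11,15) assms(16)[rule_format] assms(13,14)])
      fix U V :: "'a set" and \<epsilon> :: real and K
      assume UV: "U \<in> \<A>" "V \<in> \<A>" "U \<noteq> {}" "V \<noteq> {}" and "\<epsilon> > 0"
      then obtain q where q: "1 / real (Suc q) \<le> \<epsilon>"
        using reals_Archimedean[of \<epsilon>] by (auto simp: inverse_eq_divide intro: less_imp_le)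
      obtain k where k: "k \<ge> K" "(f ^^ n k) (fst p) \<in> U" "(f ^^ n k) (snd p) \<in> V" "?good q k p"
        using elim UV by blast
      show "\<exists>k\<ge>K. (f ^^ n k) (fst p) \<in> U \<and> (f ^^ n k) (snd p) \<in> V \<and>
          growth_within f h \<gamma> \<epsilon> (n k) (fst p) \<and> growth_within f h \<gamma> \<epsilon> (n k) (snd p)"
        using k(1-3) growth_within_mono[OF conjunct1[OF k(4)] q] growth_within_mono[OF conjunct2[OF k(4)] q]
        by blast
    qed (use assms(18-20) in auto)
  qed
  define E where "E = {(a, b). \<exists>x y. ((a, x), (b, y)) \<in> transitive_points (map_prod P P)}"
  have AE_E: "AE p in \<mu> \<Otimes>\<^sub>M \<mu>. p \<in> E"
    using AE_trans by (simp add: E_def case_prod_unfold)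
  let ?C = "completion (\<mu> \<Otimes>\<^sub>M \<mu>)"
  interpret completion: prob_space ?C
    by (rule square.prob_space_completion)
  \<comment> \<open>\<open>E\<close> is a projection of the transitive points; its complement is
    contained in a null set, so it is measurable for the completed product measure.\<close>
  have "{p \<in> space ?C. p \<notin> E} \<in> sets ?C"
    using sets_completion_AE[of "\<lambda>p. p \<notin> E" "\<mu> \<Otimes>\<^sub>M \<mu>"] AE_E by (simp add: pred_def)
  then have "space ?C - {p \<in> space ?C. p \<notin> E} \<in> sets ?C"
    by (rule sets.compl_sets)
  also have "space ?C - {p \<in> space ?C. p \<notin> E} = E"
    by (auto simp: space_pair_measure space_\<mu>)
  finally have prob_E: "measure ?C E = 1"
    using AE_E by (simp add: completion.prob_eq_1 AE_completion)
  \<comment> \<open>Measure 1 makes \<open>E\<close> nonempty, and a single transitive point yields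
    topological weak mixing.\<close>
  then have "E \<noteq> {}"
    by auto
  then obtain p where p: "p \<in> transitive_points (map_prod P P)"
    by (auto simp: E_def)
  have "continuous_on UNIV P"
    unfolding assms(12) by (intro continuous_on_skew_product assms)
  then have "continuous_on UNIV (\<lambda>z. P (fst z))" "continuous_on UNIV (\<lambda>z. P (snd z))"
    by (rule continuous_on_compose2; simp add: continuous_on_fst continuous_on_snd)+
  then have "continuous_on UNIV (map_prod P P)"
    unfolding map_prod_def case_prod_beta by (rule continuous_on_Pair)
  \<comment> \<open>The first projections are open maps, so an open singleton in the product would
    give one in the perfect base space.\<close>
  moreover have "\<not> open {q}" for q :: "('a \<times> 'x) \<times> ('a \<times> 'x)"
    using open_image_fst[of "{q}"] open_image_fst[of "{fst q}"] not_open_singleton[of "fst (fst q)"] by auto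
  ultimately have "topologically_transitive (map_prod P P)"
    using p by (intro transitive_point_imp_topologically_transitive)
  with prob_E show ?thesis
    by (simp add: topologically_weakly_mixing_def E_def)
qed

end
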